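(* Let $k\ge 2$, let $U$ be a finite nonempty set, and let $f:\{0,\ldots,k\}^U\to\mathbb{R}_{+}$ be $k$-submodular. Let $\mathbf{s}$ be the solution produced by the deterministic greedy algorithm on $f$ (for an arbitrary processing order of $U$), and let $\mathbf{o}$ be an optimal solution, i.e. a maximizer of $f$ over $\{0,\ldots,k\}^U$. Then \[f(\mathbf{s})\ \ge\ \tfrac13 f(\mathbf{o}).\]
   Context: $\mathbb{R}_{+}$ denotes the non-negative reals. For $s,t\in\{0,\ldots,k\}$ define $\mathrm{min}_0(s,t)=0$ if $s\neq 0$, $t\neq 0$ and $s\neq t$, and $\mathrm{min}_0(s,t)=\min(s,t)$ otherwise; define $\mathrm{max}_0(s,t)=0$ if $s\neq 0$, $t\neq 0$ and $s\neq t$, and $\mathrm{max}_0(s,t)=\max(s,t)$ otherwise. Both are applied coordinate-wise to vectors. $f$ is $k$-submodular if $f(\mathbf{s})+f(\mathbf{t})\ge f(\mathrm{min}_0(\mathbf{s},\mathbf{t}))+f(\mathrm{max}_0(\mathbf{s},\mathbf{t}))$ for all $\mathbf{s},\mathbf{t}\in\{0,\ldots,k\}^U$. For $e\in U$, $i\in\{1,\ldots,k\}$ and $\mathbf{s}$ with $s_e=0$, let $f_{i,e}(\mathbf{s})=f(\mathbf{s}+i\cdot\mathbf{1}_e)-f(\mathbf{s})$, where $\mathbf{1}_e$ is the unit vector of coordinate $e$. Deterministic greedy algorithm: start with $\mathbf{s}=\mathbf{0}$. Process the elements of $U$ one at a time in an arbitrary order; when processing $e$, compute $y_i=f_{i,e}(\mathbf{s})$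 for $i=1,\ldots,k$ with respect to the current $\mathbf{s}$, let $q$ be the smallest index with $y_q=\max(y_1,\ldots,y_k)$, and permanently set $s_e\gets q$. After all elements have been processed, return $\mathbf{s}$. *)

theory Defs
  imports Complex_Main "HOL-Library.FuncSet"
begin

text \<open>
  A vector in \<open>{0,\<dots>,k}\<^sup>U\<close> is an extensional function from \<open>U\<close> to \<open>{0..k}\<close>,
  so each vector has exactly one representation and is \<open>undefined\<close> outside \<open>U\<close>.
  Coordinatewise operations are therefore restricted to \<open>U\<close>.
\<close>

definition k_vectors :: "nat \<Rightarrow> 'a set \<Rightarrow> ('a \<Rightarrow> nat) set" where
  "k_vectors k U = (U \<rightarrow>\<^sub>E {0..k})"

definition min0 :: "nat \<Rightarrow> nat \<Rightarrow> nat" where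
  "min0 s t = (if s \<noteq> 0 \<and> t \<noteq> 0 \<and> s \<noteq> t then 0 else min s t)"

definition max0 :: "nat \<Rightarrow> nat \<Rightarrow> nat" where
  "max0 s t = (if s \<noteq> 0 \<and> t \<noteq> 0 \<and> s \<noteq> t then 0 else max s t)"

definition k_submodular :: "nat \<Rightarrow> 'a set \<Rightarrow> (('a \<Rightarrow> nat) \<Rightarrow> real) \<Rightarrow> bool" where
  "k_submodular k U f \<longleftrightarrow>
     (\<forall>s \<in> k_vectors k U. \<forall>t \<in> k_vectors k U.
        f s + f t \<ge> f (\<lambda>e\<in>U. min0 (s e) (t e)) + f (\<lambda>e\<in>U. max0 (s e) (t e)))"

text \<open>The marginal value \<open>f\<^sub>i\<^sub>,\<^sub>e(s)\<close>, meaningful for \<open>e \<in> U\<close> with \<open>s e = 0\<close> and \<open>1 \<le> i \<le> k\<close>.\<close>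

definition marginal :: "(('a \<Rightarrow> nat) \<Rightarrow> real) \<Rightarrow> nat \<Rightarrow> 'a \<Rightarrow> ('a \<Rightarrow> nat) \<Rightarrow> real" where
  "marginal f i e s = f (s(e := s e + i)) - f s"

definition greedy_choice :: "nat \<Rightarrow> (('a \<Rightarrow> nat) \<Rightarrow> real) \<Rightarrow> 'a \<Rightarrow> ('a \<Rightarrow> nat) \<Rightarrow> nat" where
  "greedy_choice k f e s =
     (LEAST q. q \<in> {1..k} \<and> marginal f q e s = Max ((\<lambda>i. marginal f i e s) ` {1..k}))"

definition greedy_step ::
    "nat \<Rightarrow> (('a \<Rightarrow> nat) \<Rightarrow> real) \<Rightarrow> 'a \<Rightarrow> ('a \<Rightarrow> nat) \<Rightarrow> ('a \<Rightarrow> nat)" where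
  "greedy_step k f e s = s(e := greedy_choice k f e s)"

text \<open>The list \<open>es\<close> gives the processing order, from left to right.\<close>

definition greedy ::
    "nat \<Rightarrow> 'a set \<Rightarrow> (('a \<Rightarrow> nat) \<Rightarrow> real) \<Rightarrow> 'a list \<Rightarrow> ('a \<Rightarrow> nat)" where
  "greedy k U f es = fold (greedy_step k f) es (\<lambda>e\<in>U. 0)"

end

theory Submission
  imports Defs
begin

text \<open>
  Along the run of the greedy algorithm, overwrite the optimal solution by the labels chosen so far.
  In each step the hybrid solution loses at most twice the gain of the greedy solution: by
  orthant submodularity the marginals at the hybrid are bounded by those at the greedy solution,
  and by pairwise monotonicity removing the chosen label costs at most the marginal of any other
  label. Telescoping gives \<open>f(o) - f(s) \<le> 2 (f(s) - f(0)) \<le> 2 f(s)\<close>.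
\<close>

lemma k_vectors_upd:
  assumes "s \<in> k_vectors k U" "e \<in> U" "q \<le> k"
  shows "s(e := q) \<in> k_vectors k U"
  using assms by (auto simp: k_vectors_def PiE_iff extensional_def)

lemma k_vectors_eqI:
  assumes "s \<in> k_vectors k U" "t \<in> k_vectors k U" "\<And>e. e \<in> U \<Longrightarrow> s e = t e"
  shows "s = t"
  using assms unfolding k_vectors_def by (rule PiE_ext)

lemma restrict_k_vectors_eq:
  assumes "t \<in> k_vectors k U" "\<And>e. e \<in> U \<Longrightarrow> g e = t e"
  shows "(\<lambda>e\<in>U. g e) = t"
  using assms by (auto simp: k_vectors_def PiE_iff extensional_def fun_eq_iff)

text \<open>Apply \<open>k_submodular\<close> to \<open>s(e := i)\<close> and \<open>t\<close>. As
  \<open>s\<close> lies below \<open>t\<close> and both vanish at \<open>e\<close>,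
  \<open>min0\<close> returns \<open>s\<close> and \<open>max0\<close> returns
  \<open>t(e := i)\<close>.\<close>

lemma orthant_submodular:
  assumes f: "k_submodular k U f"
    and s: "s \<in> k_vectors k U" and t: "t \<in> k_vectors k U"
    and le: "\<And>x. x \<in> U \<Longrightarrow> s x = 0 \<or> s x = t x"
    and e: "e \<in> U" "t e = 0" and i: "i \<le> k"
  shows "marginal f i e t \<le> marginal f i e s"
proof -
  have se: "s e = 0" using le e by force
  have si: "s(e := i) \<in> k_vectors k U" and ti: "t(e := i) \<in> k_vectors k U"
    using s t e(1) i by (simp_all only: k_vectors_upd)
  have "(\<lambda>x\<in>U. min0 ((s(e := i)) x) (t x)) = s"
    by (rule restrict_k_vectors_eq[OF s]) (use le e se in \<open>force simp: min0_def\<close>)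
  moreover have "(\<lambda>x\<in>U. max0 ((s(e := i)) x) (t x)) = t(e := i)"
    by (rule restrict_k_vectors_eq[OF ti]) (use le e se in \<open>force simp: max0_def\<close>)
  ultimately have "f (s(e := i)) + f t \<ge> f s + f (t(e := i))"
    using f si t unfolding k_submodular_def by metis
  then show ?thesis using e se by (simp add: marginal_def)
qed

text \<open>Two different nonzero labels at \<open>e\<close> are sent to 0 by both
  \<open>min0\<close> and \<open>max0\<close>, so the pair \<open>t(e := i)\<close>,
  \<open>t(e := j)\<close> yields \<open>t\<close> twice.\<close>

lemma pairwise_monotone:
  assumes f: "k_submodular k U f" and t: "t \<in> k_vectors k U"
    and e: "e \<in> U" "t e = 0" and ij: "i \<in> {1..k}" "j \<in> {1..k}" "i \<noteq> j"
  shows "marginal f i e t + marginal f j e t \<ge> 0"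
proof -
  have "t(e := i) \<in> k_vectors k U" and "t(e := j) \<in> k_vectors k U"
    using k_vectors_upd[OF t e(1)] ij by simp_all
  moreover have "(\<lambda>x\<in>U. min0 ((t(e := i)) x) ((t(e := j)) x)) = t"
    by (rule restrict_k_vectors_eq[OF t]) (use e ij in \<open>auto simp: min0_def\<close>)
  moreover have "(\<lambda>x\<in>U. max0 ((t(e := i)) x) ((t(e := j)) x)) = t"
    by (rule restrict_k_vectors_eq[OF t]) (use e ij in \<open>auto simp: max0_def\<close>)
  ultimately have "f (t(e := i)) + f (t(e := j)) \<ge> f t + f t"
    using f unfolding k_submodular_def by metis
  then show ?thesis using e by (simp add: marginal_def)
qed

lemma
  assumes "k \<ge> 1"
  shows greedy_choice_in: "greedy_choice k f e s \<in> {1..k}"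
    and greedy_choice_max:
      "i \<in> {1..k} \<Longrightarrow> marginal f i e s \<le> marginal f (greedy_choice k f e s) e s"
proof -
  let ?M = "(\<lambda>i. marginal f i e s) ` {1..k}"
  have "Max ?M \<in> ?M"
    using assms by (intro Max_in) auto
  then obtain q where "q \<in> {1..k} \<and> marginal f q e s = Max ?M"
    by auto
  then have *: "greedy_choice k f e s \<in> {1..k} \<and> marginal f (greedy_choice k f e s) e s = Max ?M"
    unfolding greedy_choice_def by (rule LeastI)
  then show "greedy_choice k f e s \<in> {1..k}" by blast
  show "marginal f i e s \<le> marginal f (greedy_choice k f e s) e s" if "i \<in> {1..k}"
    using * that by simp
qed

lemma greedy_step_loss:
  assumes k: "k \<ge> 2" and f: "k_submodular k U f"
    and s: "s \<in> k_vectors k U" and u: "u \<in> k_vectors k U"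
    and le: "\<And>x. x \<in> U \<Longrightarrow> s x = 0 \<or> s x = u x"
    and e: "e \<in> U" "s e = 0"
  defines "q \<equiv> greedy_choice k f e s"
  shows "f u - f (u(e := q)) \<le> 2 * (f (s(e := q)) - f s)"
proof -
  \<comment> \<open>Both \<open>u\<close> and \<open>u(e := q)\<close> extend \<open>t\<close> by at
    most one label at \<open>e\<close>, so the loss is a difference of two terms measured at
    \<open>t\<close>; each contributes at most one greedy gain.\<close>
  define t where "t = u(e := 0)"
  have t: "t \<in> k_vectors k U" unfolding t_def using u e by (intro k_vectors_upd) auto
  have q: "q \<in> {1..k}" and max: "\<And>i. i \<in> {1..k} \<Longrightarrow> marginal f i e s \<le> marginal f q e s"
    unfolding q_def using k by (auto intro!: greedy_choice_max greedy_choice_in[simplified])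
  \<comment> \<open>Since \<open>s e = 0\<close>, clearing \<open>e\<close> in \<open>u\<close>
    keeps \<open>s\<close> below \<open>t\<close>, so orthant submodularity applies.\<close>
  have bound: "marginal f i e t \<le> marginal f q e s" if "i \<in> {1..k}" for i
  proof -
    have "marginal f i e t \<le> marginal f i e s"
      using f s t by (rule orthant_submodular) (use le e that in \<open>auto simp: t_def\<close>)
    with max[OF that] show ?thesis by linarith
  qed
  have te: "t e = 0" by (simp add: t_def)
  \<comment> \<open>A label competing with \<open>q\<close> exists because \<open>k \<ge> 2\<close>;
    pairing it with \<open>q\<close> limits how negative the marginal of \<open>q\<close> can
    be.\<close>
  obtain r where r: "r \<in> {1..k}" "r \<noteq> q"
    using k by (intro that[of "if q = 1 then 2 else 1"]) auto
  have lossr: "- marginal f q e t \<le> marginal f q e s"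
    using pairwise_monotone[OF f t e(1) te r(1) q r(2)] bound[OF r(1)] by linarith
  \<comment> \<open>This covers a hybrid with \<open>u e = 0\<close>, where clearing
    \<open>e\<close> changes nothing.\<close>
  have nonneg: "0 \<le> marginal f q e s"
    using pairwise_monotone[OF f s e r(1) q r(2)] max[OF r(1)] by linarith
  have "f u - f t \<le> marginal f q e s"
  proof (cases "u e = 0")
    case True
    then have "t = u" by (auto simp: t_def)
    then show ?thesis using nonneg by simp
  next
    case False
    then have "u e \<in> {1..k}" using u e by (auto simp: k_vectors_def PiE_iff)
    moreover have "marginal f (u e) e t = f u - f t" by (simp add: marginal_def t_def)
    ultimately show ?thesis using bound by metis
  qed
  moreover have "marginal f q e t = f (u(e := q)) - f t" by (simp add: marginal_def t_def)
  moreover have "marginal f q e s = f (s(e := q)) - f s" using e by (simp add: marginal_def)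
  ultimately show ?thesis using lossr by argo
qed

text \<open>Both vectors vary so that the invariant survives induction: \<open>s\<close> is 0 on
  pending elements and agrees with \<open>u\<close> on the others. Each step writes the same label
  into both, the losses telescope, and once the list is empty the two coincide.\<close>

lemma fold_greedy_step_loss:
  assumes k: "k \<ge> 2" and f: "k_submodular k U f"
    and "s \<in> k_vectors k U" and "u \<in> k_vectors k U"
    and "distinct es" and "set es \<subseteq> U"
    and "\<And>e. e \<in> set es \<Longrightarrow> s e = 0"
    and "\<And>e. e \<in> U - set es \<Longrightarrow> s e = u e"
  defines "g \<equiv> fold (greedy_step k f) es s"
  shows "f u - f g \<le> 2 * (f g - f s)"
  unfolding g_def using assms(3-8)
proof (induction es arbitrary: s u)
  case Nil
  then have "s = u" by (auto intro: k_vectors_eqI)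
  with Nil show ?case by simp
next
  case (Cons e es)
  let ?q = "greedy_choice k f e s"
  have q: "?q \<in> {1..k}" using k by (intro greedy_choice_in) auto
  have e: "e \<in> U" "s e = 0" using Cons.prems by auto
  have "f u - f (u(e := ?q)) \<le> 2 * (f (s(e := ?q)) - f s)"
    using k f Cons.prems(1,2) _ e by (rule greedy_step_loss) (use Cons.prems in auto)
  moreover have "f (u(e := ?q)) - f (fold (greedy_step k f) es (s(e := ?q)))
    \<le> 2 * (f (fold (greedy_step k f) es (s(e := ?q))) - f (s(e := ?q)))"
  proof (rule Cons.IH)
    show "s(e := ?q) \<in> k_vectors k U" "u(e := ?q) \<in> k_vectors k U"
      using Cons.prems(1,2) q e by (simp_all add: k_vectors_upd)
  qed (use Cons.prems in auto)
  moreover have "fold (greedy_step k f) (e # es) s = fold (greedy_step k f) es (s(e := ?q))"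
    by (simp add: greedy_step_def[of _ _ e])
  ultimately show ?case by auto
qed

theorem corollary17:
  fixes k :: nat and U :: "'a set" and f :: "('a \<Rightarrow> nat) \<Rightarrow> real"
    and es :: "'a list" and s opt :: "'a \<Rightarrow> nat"
  assumes "k \<ge> 2"
    and "finite U" and "U \<noteq> {}"
    and "\<And>t. t \<in> k_vectors k U \<Longrightarrow> f t \<ge> 0"
    and "k_submodular k U f"
    and "distinct es" and "set es = U"
    and "s = greedy k U f es"
    and "is_arg_max f (\<lambda>t. t \<in> k_vectors k U) opt"
  shows "f s \<ge> 1 / 3 * f opt"
proof -
  have zero: "(\<lambda>e\<in>U. 0) \<in> k_vectors k U" by (auto simp: k_vectors_def)
  have opt: "opt \<in> k_vectors k U" using assms(9) by (simp add: is_arg_max_def)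
  \<comment> \<open>Initially every element of \<open>U\<close> is pending, so any \<open>u\<close>,
    in particular \<open>opt\<close>, satisfies the invariant.\<close>
  have "f opt - f s \<le> 2 * (f s - f (\<lambda>e\<in>U. 0))"
    unfolding assms(8) greedy_def
    using assms(1,5) zero opt assms(6) by (rule fold_greedy_step_loss) (use assms(7) in auto)
  \<comment> \<open>Rearranged, \<open>3 * f s - f opt\<close> is at least twice the value at the
    zero vector, which is nonnegative.\<close>
  with assms(4)[OF zero] show ?thesis by simp
qed

end
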